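(* Let $H$ be a Hilbert space and let $f:H\to\mathbb{R}\cup\{+\infty\}$ be lower semicontinuous and bounded below. Let $x_0\in\mathrm{dom}(f)$ with $\partial_p f(x_0)\neq\emptyset$, and define the level set $\Omega:=\{x\in H: f(x)\le f(x_0)\}$. Suppose that there exist $\delta,L>0$ such that $f$ is uniformly prox-regular on the set $B(\Omega,\delta):=\{x\in H: d(x,\Omega)<\delta\}$ and $$\partial_p f(y)\subset \partial_p f(z)+L\|y-z\|B_H\qquad\text{for all } y\in\Omega \text{ and } z\in H \text{ with } \|y-z\|<\delta .$$ Then Algorithm NSDM started at $x_0$ is valid, in the sense that $\Omega\subset\{x\in H:\partial_p f(x)\neq\emptyset\}$ (so that a proximal subgradient can be chosen at every iterate, all iterates lying in $\Omega$), and for every sequence $\{x_n: n=0,1,\dots\}$ generated by Algorithm NSDM, every cluster point $\bar x$ of $\{x_n\}$ (in the norm topology) is a stationary point of $f$, that is, $0\in\partial f(\bar x)$.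
   Context: $H$ is a Hilbert space with inner product $\langle\cdot,\cdot\rangle$ and norm $\|\cdot\|$; $B(x,r)$ is the open ball with center $x$ and radius $r$; $B_H$ is the closed unit ball of $H$; $d(x,S):=\inf\{\|x-s\|:s\in S\}$; $\mathrm{dom}(f):=\{y: f(y)<+\infty\}$; $\mathrm{epi} f:=\{(x,\alpha)\in H\times\mathbb{R}: f(x)\le\alpha\}$. Proximal normal cone: for a set $S$ in a Hilbert space and $x\in S$, $N^p(S,x)$ is the set of all $\zeta=t(z-x)$ with $t>0$ and $z$ such that $\|z-x\|=d(z,S)$. Proximal subdifferential: for $f$ lower semicontinuous and $x\in\mathrm{dom}(f)$, $\partial_p f(x):=\{\zeta\in H:(\zeta,-1)\in N^p(\mathrm{epi}f,(x,f(x)))\}$; equivalently, $\zeta\in\partial_p f(x)$ iff there exist $r,\eta>0$ with $f(y)\ge f(x)+\langle\zeta,y-x\rangle-\frac r2\|y-x\|^2$ for all $y\in B(x,\eta)$. For $x\notin\mathrm{dom}(f)$, $\partial_p f(x)=\emptyset$. Limiting (Mordukhovich) subdifferential: for $x\in\mathrm{dom}(f)$, $\zeta\in\partial f(x)$ iff there exist sequences $x_n\to x$ with $f(x_n)\to f(x)$ and $\zeta_n\to\zeta$ weakly such that $\zeta_n\in\partial_p f(x_n)$ for all $n$. Uniform prox-regularity: $f$ is uniformly prox-regular on $E\subset H$ iff there exist $\delta'>0$ and $L'>0$ such that for any $\bar y\in E$ and $\bar w\in\partial_p f(\bar y)$ one has $$f(y')\ge f(y)+\langle w,y'-y\rangle-\tfrac{L'}{2}\|y'-y\|^2\qquad\forall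 y'\in B(\bar y,\delta'),$$ whenever $y\in B(\bar y,\delta')$ with $|f(y)-f(\bar y)|<\delta'$ and $w\in\partial_p f(y)\cap B(\bar w,\delta')$. Algorithm NSDM. Start from $x_0$ with $\partial_p f(x_0)\neq\emptyset$. For $n=1,2,\dots$: choose any $v_{n-1}\in\partial_p f(x_{n-1})$. If $v_{n-1}=0$, terminate. Otherwise set $u_{n-1}:=-v_{n-1}/\|v_{n-1}\|$ and $x_n:=x_{n-1}+\varepsilon_{n-1}u_{n-1}$, where $\varepsilon_{n-1}\ge 0$ is chosen such that $f(x_{n-1}+\varepsilon_{n-1}u_{n-1})=\min_{t\ge0}f(x_{n-1}+tu_{n-1})$ (exact line search; a sequence generated by the algorithm is one for which such step lengths have been chosen, i.e. the minimum is attained at each step). Convention: if the algorithm terminates at $x_{n-1}$, the sequence is continued by $x_k:=x_{n-1}$ for all $k\ge n$. *)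

theory Defs
  imports "HOL-Analysis.Analysis"
begin

definition dom_fun :: "('a \<Rightarrow> ereal) \<Rightarrow> 'a set" where
  "dom_fun f = {y. f y < \<infinity>}"

definition epi :: "('a \<Rightarrow> ereal) \<Rightarrow> ('a \<times> real) set" where
  "epi f = {(x, \<alpha>). f x \<le> ereal \<alpha>}"

definition lower_semicont :: "('a::topological_space \<Rightarrow> ereal) \<Rightarrow> bool" where
  "lower_semicont f \<longleftrightarrow> (\<forall>x. f x \<le> Liminf (at x) f)"

definition proximal_normal_cone :: "'a::real_inner set \<Rightarrow> 'a \<Rightarrow> 'a set" where
  "proximal_normal_cone S x =
     {\<zeta>. x \<in> S \<and> (\<exists>t z. t > 0 \<and> norm (z - x) = infdist z S \<and> \<zeta> = t *\<^sub>R (z - x))}"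

(* The normal cone is taken in the product space, whose inner product is
   (a, \<alpha>) \<bullet> (b, \<beta>) = a \<bullet> b + \<alpha> * \<beta>.  The coercion real_of_ereal sends infinite values
   to 0; the functions considered never take the value -\<infinity>, and the value \<infinity> is excluded
   by x \<in> dom_fun f. *)
definition proximal_subdiff :: "('a::real_inner \<Rightarrow> ereal) \<Rightarrow> 'a \<Rightarrow> 'a set" where
  "proximal_subdiff f x =
     {\<zeta>. x \<in> dom_fun f \<and> (\<zeta>, -1) \<in> proximal_normal_cone (epi f) (x, real_of_ereal (f x))}"

definition weakly_converges :: "(nat \<Rightarrow> 'a::real_inner) \<Rightarrow> 'a \<Rightarrow> bool" where
  "weakly_converges X l \<longleftrightarrow> (\<forall>h. (\<lambda>n. X n \<bullet> h) \<longlonglongrightarrow> l \<bullet> h)"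

definition limiting_subdiff :: "('a::real_inner \<Rightarrow> ereal) \<Rightarrow> 'a \<Rightarrow> 'a set" where
  "limiting_subdiff f x =
     {\<zeta>. x \<in> dom_fun f \<and>
          (\<exists>X Z. X \<longlonglongrightarrow> x \<and> (\<lambda>n. f (X n)) \<longlonglongrightarrow> f x \<and> weakly_converges Z \<zeta> \<and>
                 (\<forall>n. Z n \<in> proximal_subdiff f (X n)))}"

definition uniformly_prox_regular_on :: "'a::real_inner set \<Rightarrow> ('a \<Rightarrow> ereal) \<Rightarrow> bool" where
  "uniformly_prox_regular_on E f \<longleftrightarrow>
     (\<exists>\<delta>'>0. \<exists>L'>0. \<forall>ybar\<in>E. \<forall>wbar\<in>proximal_subdiff f ybar.
        \<forall>y\<in>ball ybar \<delta>'. \<forall>w\<in>proximal_subdiff f y \<inter> ball wbar \<delta>'.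
          \<bar>f y - f ybar\<bar> < ereal \<delta>' \<longrightarrow>
          (\<forall>y'\<in>ball ybar \<delta>'.
             f y + ereal (w \<bullet> (y' - y)) - ereal (L' / 2 * (norm (y' - y))\<^sup>2) \<le> f y'))"

definition exact_line_search :: "('a::real_normed_vector \<Rightarrow> ereal) \<Rightarrow> 'a \<Rightarrow> 'a \<Rightarrow> real \<Rightarrow> bool" where
  "exact_line_search f a u \<epsilon> \<longleftrightarrow> is_arg_min (\<lambda>t. f (a + t *\<^sub>R u)) (\<lambda>t. 0 \<le> t) \<epsilon>"

(* The step from iterate n to iterate n + 1, given all previously chosen subgradients v k.
   Once some v k = 0 the algorithm has terminated, and the sequence is continued
   constantly; no further subgradients are then chosen. *)
definition nsdm_step ::
    "('a::real_inner \<Rightarrow> ereal) \<Rightarrow> (nat \<Rightarrow> 'a) \<Rightarrow> (nat \<Rightarrow> 'a) \<Rightarrow> nat \<Rightarrow> bool" where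
  "nsdm_step f x v n \<longleftrightarrow>
     (if \<exists>k<n. v k = 0 then x (Suc n) = x n
      else v n \<in> proximal_subdiff f (x n) \<and>
           (if v n = 0 then x (Suc n) = x n
            else let u = - (v n /\<^sub>R norm (v n)) in
              \<exists>\<epsilon>. exact_line_search f (x n) u \<epsilon> \<and> x (Suc n) = x n + \<epsilon> *\<^sub>R u))"

(* A partial run: only the iterates x 0, ..., x N are constrained. *)
definition nsdm_run ::
    "('a::real_inner \<Rightarrow> ereal) \<Rightarrow> 'a \<Rightarrow> nat \<Rightarrow> (nat \<Rightarrow> 'a) \<Rightarrow> (nat \<Rightarrow> 'a) \<Rightarrow> bool" where
  "nsdm_run f x0 N x v \<longleftrightarrow> x 0 = x0 \<and> (\<forall>n<N. nsdm_step f x v n)"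

definition nsdm_sequence :: "('a::real_inner \<Rightarrow> ereal) \<Rightarrow> 'a \<Rightarrow> (nat \<Rightarrow> 'a) \<Rightarrow> bool" where
  "nsdm_sequence f x0 x \<longleftrightarrow> (\<exists>v. x 0 = x0 \<and> (\<forall>n. nsdm_step f x v n))"

definition cluster_point :: "(nat \<Rightarrow> 'a::topological_space) \<Rightarrow> 'a \<Rightarrow> bool" where
  "cluster_point x l \<longleftrightarrow> (\<exists>r. strict_mono r \<and> (x \<circ> r) \<longlonglongrightarrow> l)"

end

(* A Borwein-Preiss type variational principle yields, arbitrarily close to any point y of the level
   set, points of proximal subdifferentiability where f does not exceed f y; the Lipschitz-type
   inclusion then carries nonemptiness of the subdifferential over to y.  Uniform prox-regularity
   with y = ybar and w = wbar gives a quadratic lower bound of fixed radius and modulus around every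
   z near the level set.  Combined with the inclusion, it also gives a uniform quadratic upper bound,
   so along an exact line search f (x (n+1)) \<le> f (x n) - t * norm (v n) + K * t^2 for all small t.
   As f (x n) converges, v n tends to 0; by the inclusion once more, the subdifferential at the
   cluster point contains vectors of arbitrarily small norm. *)
theory Submission
  imports Defs
begin

section \<open>Semicontinuity along sequences, near minimizers, series\<close>

text \<open>\<open>Liminf\<close> at \<open>v\<close> ignores the value at \<open>v\<close>; since
  \<open>a < f v\<close> also holds there, the bound extends to a full neighbourhood, so
  \<open>X\<close> may hit \<open>v\<close>.\<close>

lemma lower_semicont_LIMSEQ_le:
  fixes f :: "'a::t1_space \<Rightarrow> ereal"
  assumes "lower_semicont f" and "X \<longlonglongrightarrow> v" and "r \<longlonglongrightarrow> r0"
    and le: "eventually (\<lambda>n. f (X n) \<le> ereal (r n)) sequentially"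
  shows "f v \<le> ereal r0"
proof (rule dense_le)
  fix a assume a: "a < f v"
  have "f v \<le> Liminf (at v) f"
    using assms(1) by (simp add: lower_semicont_def)
  with a have "eventually (\<lambda>z. a < f z) (at v)"
    by (simp add: le_Liminf_iff)
  with a have "eventually (\<lambda>z. a < f z) (nhds v)"
    by (auto simp: eventually_at_filter elim: eventually_mono)
  then have "eventually (\<lambda>n. a < f (X n)) sequentially"
    using assms(2) by (rule eventually_compose_filterlim)
  with le have "eventually (\<lambda>n. a \<le> ereal (r n)) sequentially"
    by eventually_elim auto
  moreover have "(\<lambda>n. ereal (r n)) \<longlonglongrightarrow> ereal r0"
    using assms(3) by simp
  ultimately show "a \<le> ereal r0"
    by (intro tendsto_lowerbound[of "\<lambda>n. ereal (r n)"]) auto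
qed

text \<open>If a point with value close to the infimum lies above \<open>h x\<close>, then
  \<open>x\<close> itself is at least as close to the infimum.\<close>

lemma ex_near_minimizer:
  fixes h :: "'a \<Rightarrow> real"
  assumes "x \<in> D" and "\<And>z. z \<in> D \<Longrightarrow> m \<le> h z" and "e > 0"
  shows "\<exists>x'\<in>D. h x' \<le> h x \<and> (\<forall>z\<in>D. h x' \<le> h z + e)"
proof -
  have bdd: "bdd_below (h ` D)"
    using assms(2) by (auto simp: bdd_below_def)
  have "Inf (h ` D) < Inf (h ` D) + e"
    using assms(3) by simp
  then obtain z0 where z0: "z0 \<in> D" "h z0 < Inf (h ` D) + e"
    using cInf_less_iff[of "h ` D" "Inf (h ` D) + e"] bdd assms(1) by auto
  have near: "h z0 \<le> h z + e" if "z \<in> D" for z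
    using cInf_lower[OF imageI[OF that] bdd] z0(2) by simp
  show ?thesis
  proof (cases "h z0 \<le> h x")
    case True
    with z0(1) near show ?thesis by blast
  next
    case False
    with assms(1) near show ?thesis by (intro bexI[of _ x]) fastforce+
  qed
qed

lemma norm_diff_sq_expand:
  fixes x v p :: "'a::real_inner"
  shows "(norm (x - p))\<^sup>2 = (norm (v - p))\<^sup>2 + 2 * ((v - p) \<bullet> (x - v)) + (norm (x - v))\<^sup>2"
  by (simp add: power2_norm_eq_inner inner_commute algebra_simps)

(* The sort {real_normed_vector, complete_space} is not known to imply banach, so
   summable_comparison_test' is not applicable. *)
lemma summable_norm_comparison_complete:
  fixes h :: "nat \<Rightarrow> 'a::{real_normed_vector, complete_space}"
  assumes "summable b" and le: "\<And>i. norm (h i) \<le> b i"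
  shows "summable h"
proof -
  have "Cauchy (\<lambda>n. \<Sum>i<n. h i)"
    unfolding Cauchy_altdef2
  proof (intro allI impI)
    fix e :: real assume "e > 0"
    moreover have "Cauchy (\<lambda>n. \<Sum>i<n. b i)"
      using assms(1) by (simp add: summable_iff_convergent convergent_Cauchy)
    ultimately obtain N where N: "\<And>n. n \<ge> N \<Longrightarrow> dist (\<Sum>i<n. b i) (\<Sum>i<N. b i) < e"
      unfolding Cauchy_altdef2 by blast
    have "dist (\<Sum>i<n. h i) (\<Sum>i<N. h i) < e" if "n \<ge> N" for n
    proof -
      have diff_h: "(\<Sum>i<n. h i) - (\<Sum>i<N. h i) = (\<Sum>i=N..<n. h i)"
        and diff_b: "(\<Sum>i<n. b i) - (\<Sum>i<N. b i) = (\<Sum>i=N..<n. b i)"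
        using sum_diff_nat_ivl[of 0 N n] that by (simp_all add: lessThan_atLeast0)
      have "norm (\<Sum>i=N..<n. h i) \<le> (\<Sum>i=N..<n. b i)"
        by (intro sum_norm_le le)
      also have "\<dots> < e"
        using N[OF that] diff_b by (simp add: dist_norm)
      finally show ?thesis
        using diff_h by (simp add: dist_norm)
    qed
    then show "\<exists>N. \<forall>n\<ge>N. dist (\<Sum>i<n. h i) (\<Sum>i<N. h i) < e" by blast
  qed
  then show ?thesis
    by (simp add: summable_iff_convergent Cauchy_convergent_iff)
qed

section \<open>The smooth variational principle\<close>

text \<open>Weighted squared distances to successive near minimizers are added to \<open>f\<close>.
  The iterates converge to a minimizer \<open>v\<close> of the perturbed function, and as the whole
  perturbation is quadratic, minimality is a global quadratic minorant of \<open>f\<close> touching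
  at \<open>v\<close>.\<close>

lemma smooth_variational_principle:
  fixes f :: "'a::{real_inner, complete_space} \<Rightarrow> ereal"
  assumes lsc: "lower_semicont f" and lb: "\<And>x. ereal m \<le> f x"
    and fy: "f y < \<infinity>" and e: "e > 0"
  obtains v \<zeta> \<sigma> where "f v \<le> f y" and "norm (v - y) < e" and "\<sigma> > 0"
    and "\<And>x. f v + ereal (\<zeta> \<bullet> (x - v) - \<sigma> * (norm (x - v))\<^sup>2) \<le> f x"
proof -
  define D where "D = {x. f x < \<infinity>}"
  define g where "g x = real_of_ereal (f x)" for x
  have fg: "f x = ereal (g x)" if "x \<in> D" for x
    using that lb[of x] unfolding D_def g_def by (cases "f x") auto
  have g_ge: "m \<le> g x" if "x \<in> D" for x
    using lb[of x] fg[OF that] by simp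
  have yD: "y \<in> D"
    using fy by (simp add: D_def)
  \<comment> \<open>At distance \<open>e\<close> from \<open>y\<close> the first penalty equals
    \<open>g y - m + 1\<close>, more than \<open>g\<close> can drop below \<open>g y\<close>; this
    confines \<open>v\<close> to the ball of radius \<open>e\<close>.\<close>
  define c where "c = (g y - m + 1) / e\<^sup>2"
  have c_pos: "c > 0"
    using g_ge[OF yD] e by (simp add: c_def)
  define \<mu> :: "nat \<Rightarrow> real" where "\<mu> n = c * (1/2) ^ n" for n
  have \<mu>_pos: "\<mu> n > 0" for n
    using c_pos by (simp add: \<mu>_def)
  \<comment> \<open>The tolerance is the value of the next penalty term at distance
    \<open>(1/2) ^ n\<close>, so near minimality will turn into a distance estimate.\<close>
  define \<epsilon> :: "nat \<Rightarrow> real" where "\<epsilon> n = \<mu> (Suc n) * ((1/2) ^ n)\<^sup>2" for n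
  have \<epsilon>_pos: "\<epsilon> n > 0" for n
    using \<mu>_pos by (simp add: \<epsilon>_def)

  \<comment> \<open>A state pairs an iterate with the penalty function accumulated so far. In
    \<open>Q\<close> the penalty added last vanishes at the old iterate, so the penalized values
    decrease.\<close>
  define P where "P n s \<longleftrightarrow> fst s \<in> D \<and> (\<forall>z. snd s z \<ge> 0) \<and> (n = 0 \<longrightarrow> s = (y, \<lambda>z. 0))"
    for n :: nat and s :: "'a \<times> ('a \<Rightarrow> real)"
  define Q where "Q n s s' \<longleftrightarrow>
      snd s' = (\<lambda>z. snd s z + \<mu> n * (norm (z - fst s))\<^sup>2) \<and>
      g (fst s') + snd s' (fst s') \<le> g (fst s) + snd s (fst s) \<and>
      (\<forall>z\<in>D. g (fst s') + snd s' (fst s') \<le> g z + snd s' z + \<epsilon> n)"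
    for n :: nat and s s' :: "'a \<times> ('a \<Rightarrow> real)"
  have "\<exists>S. \<forall>n. P n (S n) \<and> Q n (S n) (S (Suc n))"
  proof (rule dependent_nat_choice)
    show "\<exists>s. P 0 s"
      using yD by (auto simp: P_def)
  next
    fix s n assume s: "P n s"
    define q where "q z = snd s z + \<mu> n * (norm (z - fst s))\<^sup>2" for z
    have q_ge: "q z \<ge> 0" for z
      using s \<mu>_pos[of n] by (simp add: q_def P_def)
    have "m \<le> g z + q z" if "z \<in> D" for z
      using g_ge[OF that] q_ge[of z] by simp
    with s obtain x' where "x' \<in> D" "g x' + q x' \<le> g (fst s) + q (fst s)"
        "\<forall>z\<in>D. g x' + q x' \<le> g z + q z + \<epsilon> n"
      using ex_near_minimizer[of "fst s" D m "\<lambda>z. g z + q z" "\<epsilon> n"] \<epsilon>_pos[of n]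
      unfolding P_def by blast
    then have "P (Suc n) (x', q) \<and> Q n s (x', q)"
      using q_ge by (simp add: P_def Q_def) (simp add: q_def fun_eq_iff)
    then show "\<exists>s'. P (Suc n) s' \<and> Q n s s'" by blast
  qed
  then obtain S where SP: "\<And>n. P n (S n)" and SQ: "\<And>n. Q n (S n) (S (Suc n))"
    by blast
  define X where "X n = fst (S n)" for n
  define q where "q n = snd (S n)" for n
  have XD: "X n \<in> D" for n
    using SP[of n] by (simp add: P_def X_def)
  have X0: "X 0 = y" and q0: "q 0 z = 0" for z
    using SP[of 0] by (simp_all add: P_def X_def q_def)
  have qSuc: "q (Suc n) z = q n z + \<mu> n * (norm (z - X n))\<^sup>2" for n z
    using SQ[of n] by (simp add: Q_def X_def q_def)
  have descent: "g (X (Suc n)) + q (Suc n) (X (Suc n)) \<le> g (X n) + q n (X n)" for n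
    using SQ[of n] unfolding Q_def X_def q_def by blast
  have near: "g (X (Suc n)) + q (Suc n) (X (Suc n)) \<le> g z + q (Suc n) z + \<epsilon> n"
    if "z \<in> D" for n z
    using SQ[of n] that unfolding Q_def X_def q_def by blast
  have q_sum: "q n z = (\<Sum>i<n. \<mu> i * (norm (z - X i))\<^sup>2)" for n z
    by (induction n) (simp_all add: q0 qSuc)
  have q_mono: "q k z \<le> q n z" if "k \<le> n" for k n z
    unfolding q_sum using that \<mu>_pos
    by (intro sum_mono2) (auto intro!: mult_nonneg_nonneg less_imp_le[OF \<mu>_pos])
  have G_mono: "g (X n) + q n (X n) \<le> g (X k) + q k (X k)" if "k \<le> n" for k n
    using that by (induction rule: dec_induct) (auto intro: order_trans[OF descent])
  \<comment> \<open>All later iterates lie in the sublevel set attached to stage \<open>k\<close>;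
    \<open>close\<close> shows that these sets shrink.\<close>
  have X_sub: "g (X n) + q (Suc k) (X n) \<le> g (X k) + q k (X k)" if "k < n" for k n
    using q_mono[of "Suc k" n "X n"] G_mono[of k n] that by simp
  have close: "norm (z - X (Suc n)) \<le> (1/2) ^ n"
    if z: "z \<in> D" "g z + q (Suc (Suc n)) z \<le> g (X (Suc n)) + q (Suc n) (X (Suc n))" for n z
  proof -
    have "\<mu> (Suc n) * (norm (z - X (Suc n)))\<^sup>2 \<le> \<epsilon> n"
      using near[OF z(1), of n] z(2) qSuc[of "Suc n" z] by simp
    then have "(norm (z - X (Suc n)))\<^sup>2 \<le> ((1/2) ^ n)\<^sup>2"
      using \<mu>_pos[of "Suc n"] by (simp add: \<epsilon>_def)
    then show ?thesis
      by (rule power2_le_imp_le) simp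
  qed
  have X_close: "norm (X j - X (Suc n)) \<le> (1/2) ^ n" if "Suc n \<le> j" for j n
  proof (cases "j = Suc n")
    case False
    with that have "Suc n < j" by simp
    then show ?thesis by (intro close XD X_sub)
  qed simp
  have "Cauchy X"
    unfolding Cauchy_altdef2
  proof (intro allI impI)
    fix \<eta> :: real assume "\<eta> > 0"
    then obtain n where "(1/2) ^ n < \<eta>"
      using real_arch_pow_inv[of \<eta> "1/2"] by auto
    then have "\<forall>j\<ge>Suc n. dist (X j) (X (Suc n)) < \<eta>"
      using X_close[of n] by (auto simp: dist_norm intro: le_less_trans)
    then show "\<exists>N. \<forall>j\<ge>N. dist (X j) (X N) < \<eta>" by blast
  qed
  then obtain v where v: "X \<longlonglongrightarrow> v"
    using Cauchy_convergent_iff convergent_def by blast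
  \<comment> \<open>The sublevel sets are closed by semicontinuity, so they contain
    \<open>v\<close>. With the penalty moved to the right, the bound is real and also shows
    \<open>f v\<close> finite.\<close>
  have f_v: "f v \<le> ereal (g (X k) + q k (X k) - q (Suc k) v)" for k
  proof (rule lower_semicont_LIMSEQ_le[OF lsc v])
    show "(\<lambda>n. g (X k) + q k (X k) - q (Suc k) (X n)) \<longlonglongrightarrow> g (X k) + q k (X k) - q (Suc k) v"
      unfolding q_sum by (intro tendsto_intros v)
    show "\<forall>\<^sub>F n in sequentially. f (X n) \<le> ereal (g (X k) + q k (X k) - q (Suc k) (X n))"
      using eventually_gt_at_top[of k]
    proof eventually_elim
      case (elim n)
      with X_sub[OF elim] show ?case by (simp add: fg XD)
    qed
  qed
  have vD: "v \<in> D"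
    using f_v[of 0] by (auto simp: D_def)
  have g_v: "g v + q (Suc k) v \<le> g (X k) + q k (X k)" for k
    using f_v[of k] by (simp add: fg vD)

  have v_le: "f v \<le> f y"
    using g_v[of 0] \<mu>_pos[of 0] by (simp add: fg vD yD q0 X0 qSuc)
      (smt (verit) mult_nonneg_nonneg zero_le_power2)
  have v_near: "norm (v - y) < e"
  proof -
    have "c * (norm (v - y))\<^sup>2 < c * e\<^sup>2"
      using g_v[of 0] g_ge[OF vD] e by (simp add: q0 X0 qSuc \<mu>_def) (simp add: c_def)
    then have "(norm (v - y))\<^sup>2 < e\<^sup>2"
      using c_pos by simp
    then show ?thesis
      using e by (simp add: power2_less_imp_less)
  qed
  \<comment> \<open>Once \<open>x\<close> drops out of the sublevel set of stage \<open>N\<close>,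
    it loses against \<open>v\<close> for every later partial penalty.\<close>
  have minimal: "g v + q (Suc n) v \<le> g x + q (Suc n) x"
    if x: "x \<in> D" "x \<noteq> v" and n: "N \<le> n"
      and N: "g x + q (Suc N) x > g (X N) + q N (X N)" for x n N
  proof -
    have "g v + q (Suc n) v \<le> g (X N) + q N (X N)"
      using g_v[of n] G_mono[OF n] by simp
    also have "\<dots> \<le> g x + q (Suc n) x"
      using N q_mono[of "Suc N" "Suc n" x] n by simp
    finally show ?thesis .
  qed
  \<comment> \<open>A point in all sublevel sets would also be a limit of \<open>X\<close>, hence
    equal to \<open>v\<close>.\<close>
  have ex_N: "\<exists>N. g x + q (Suc N) x > g (X N) + q N (X N)" if x: "x \<in> D" "x \<noteq> v" for x
  proof (rule ccontr)
    assume "\<nexists>N. g x + q (Suc N) x > g (X N) + q N (X N)"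
    then have *: "norm (x - X (Suc n)) \<le> (1/2) ^ n" for n
      using close[OF x(1)] by (meson not_less)
    have "(\<lambda>n. x - X (Suc n)) \<longlonglongrightarrow> 0"
    proof (rule Lim_null_comparison)
      show "\<forall>\<^sub>F n in sequentially. norm (x - X (Suc n)) \<le> (1/2) ^ n"
        using * by (intro always_eventually allI)
      show "(\<lambda>n. (1/2::real) ^ n) \<longlonglongrightarrow> 0"
        by (intro LIMSEQ_power_zero) simp
    qed
    moreover have "(\<lambda>n. x - X (Suc n)) \<longlonglongrightarrow> x - v"
      using v by (intro tendsto_intros LIMSEQ_Suc)
    ultimately show False
      using x(2) LIMSEQ_unique by fastforce
  qed

  have sums_\<mu>: "\<mu> sums (2 * c)"
    using sums_mult[OF geometric_sums[of "1/2::real"], of c] by (simp add: \<mu>_def[abs_def] mult.commute)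
  \<comment> \<open>Boundedness gives absolute convergence of the series for \<open>a\<close>;
    \<open>2 *\<^sub>R a\<close> is the gradient at \<open>v\<close> of the full perturbation, and
    \<open>2 * c\<close> is its total weight.\<close>
  obtain B where B: "\<And>i. norm (v - X i) \<le> B"
    using convergent_imp_Bseq[OF convergentI[OF tendsto_diff[OF tendsto_const[of v] v]]]
    by (rule BseqE) blast
  have summable_B: "summable (\<lambda>i. \<mu> i * B)"
    using sums_\<mu> by (intro summable_mult2) (rule sums_summable)
  have "norm (\<mu> i *\<^sub>R (v - X i)) \<le> \<mu> i * B" for i
    using B[of i] \<mu>_pos[of i] by simp
  with summable_B have "summable (\<lambda>i. \<mu> i *\<^sub>R (v - X i))"
    by (rule summable_norm_comparison_complete)
  then obtain a where a: "(\<lambda>i. \<mu> i *\<^sub>R (v - X i)) sums a"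
    by (auto simp: summable_def)
  have v_min: "f v + ereal ((- 2 *\<^sub>R a) \<bullet> (x - v) - (2 * c) * (norm (x - v))\<^sup>2) \<le> f x" for x
  proof (cases "x \<in> D \<and> x \<noteq> v")
    case True
    then obtain N where N: "g x + q (Suc N) x > g (X N) + q N (X N)"
      using ex_N by blast
    \<comment> \<open>The second-order expansion at \<open>v\<close> is exact, so only the sums of
      vectors and of weights have to pass to the limit.\<close>
    have q_diff: "q n x = q n v + (2 * ((\<Sum>i<n. \<mu> i *\<^sub>R (v - X i)) \<bullet> (x - v))
        + (\<Sum>i<n. \<mu> i) * (norm (x - v))\<^sup>2)" for n
    proof -
      have "\<mu> i * (norm (x - X i))\<^sup>2 = \<mu> i * (norm (v - X i))\<^sup>2
          + (2 * ((\<mu> i *\<^sub>R (v - X i)) \<bullet> (x - v)) + \<mu> i * (norm (x - v))\<^sup>2)" for i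
        unfolding norm_diff_sq_expand[of x "X i" v] inner_scaleR_left by (simp only: distrib_left)
      then show ?thesis
        unfolding q_sum by (simp only: sum.distrib sum_distrib_left sum_distrib_right inner_sum_left)
    qed
    have "(\<lambda>n. 2 * ((\<Sum>i<n. \<mu> i *\<^sub>R (v - X i)) \<bullet> (x - v)) + (\<Sum>i<n. \<mu> i) * (norm (x - v))\<^sup>2)
        \<longlonglongrightarrow> 2 * (a \<bullet> (x - v)) + 2 * c * (norm (x - v))\<^sup>2"
      using a sums_\<mu> unfolding sums_def by (intro tendsto_intros)
    moreover have "\<forall>\<^sub>F n in sequentially. g v - g x \<le>
        2 * ((\<Sum>i<n. \<mu> i *\<^sub>R (v - X i)) \<bullet> (x - v)) + (\<Sum>i<n. \<mu> i) * (norm (x - v))\<^sup>2"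
      using eventually_gt_at_top[of N]
    proof eventually_elim
      case (elim n)
      then obtain n' where "n = Suc n'" "N \<le> n'"
        by (cases n) auto
      then show ?case
        using minimal[of x N n'] True N q_diff[of n] by simp
    qed
    ultimately have "g v - g x \<le> 2 * (a \<bullet> (x - v)) + 2 * c * (norm (x - v))\<^sup>2"
      by (rule tendsto_lowerbound) simp
    then show ?thesis
      using True by (simp add: fg vD)
  next
    case False
    then consider "f x = \<infinity>" | "x = v"
      by (auto simp: D_def)
    then show ?thesis
      by cases auto
  qed
  show thesis
    by (rule that[OF v_le v_near _ v_min]) (use c_pos in simp)
qed

section \<open>Proximal subgradients from quadratic minorants\<close>

text \<open>The minorant keeps the epigraph outside the open ball around \<open>z\<close> whose
  boundary passes through \<open>(x, r)\<close>, so \<open>(x, r)\<close> is a nearest point of the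
  epigraph to \<open>z\<close>.\<close>

lemma proximal_subdiffI:
  fixes f :: "'a::real_inner \<Rightarrow> ereal"
  assumes fx: "f x = ereal r" and s: "\<sigma> > 0"
    and lower: "\<And>y. f x + ereal (\<zeta> \<bullet> (y - x) - \<sigma> * (norm (y - x))\<^sup>2) \<le> f y"
  shows "\<zeta> \<in> proximal_subdiff f x"
proof -
  \<comment> \<open>With \<open>2 * s * \<sigma> = 1\<close> the quadratic error is exactly absorbed
    by the squared horizontal distance.\<close>
  define s where "s = 1 / (2 * \<sigma>)"
  have s_pos: "s > 0"
    using s by (simp add: s_def)
  define z where "z = (x, r) + s *\<^sub>R (\<zeta>, -1)"
  have mem: "(x, r) \<in> epi f"
    using fx by (simp add: epi_def)
  have dist_ge: "dist z (x, r) \<le> dist z p" if "p \<in> epi f" for p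
  proof -
    obtain y \<alpha> where p: "p = (y, \<alpha>)" by (cases p)
    have "ereal (r + (\<zeta> \<bullet> (y - x) - \<sigma> * (norm (y - x))\<^sup>2)) \<le> ereal \<alpha>"
      using lower[of y] that order_trans by (fastforce simp: fx epi_def p)
    then have "2 * s * (\<zeta> \<bullet> (y - x) - (\<alpha> - r)) \<le> 2 * s * (\<sigma> * (norm (y - x))\<^sup>2)"
      using s_pos by (intro mult_left_mono) auto
    also have "\<dots> = (norm (y - x))\<^sup>2"
      using s by (simp add: s_def)
    finally have *: "2 * s * (\<zeta> \<bullet> (y - x) - (\<alpha> - r)) \<le> (norm (y - x))\<^sup>2" .
    have "(norm (z - p))\<^sup>2 = (norm (z - (x, r)))\<^sup>2 + 2 * ((z - (x, r)) \<bullet> ((x, r) - p))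
        + (norm ((x, r) - p))\<^sup>2"
      using norm_diff_sq_expand[of z p "(x, r)"] by (simp add: inner_commute)
    also have "(z - (x, r)) \<bullet> ((x, r) - p) = - (s * (\<zeta> \<bullet> (y - x) - (\<alpha> - r)))"
      by (simp add: z_def p algebra_simps)
    also have "(norm ((x, r) - p))\<^sup>2 = (norm (y - x))\<^sup>2 + (\<alpha> - r)\<^sup>2"
      by (simp add: p norm_Pair norm_minus_commute power2_commute)
    finally have "(norm (z - (x, r)))\<^sup>2 \<le> (norm (z - p))\<^sup>2"
      using * zero_le_power2[of "\<alpha> - r"] by linarith
    then show ?thesis
      unfolding dist_norm by (rule power2_le_imp_le) simp
  qed
  have "norm (z - (x, r)) = infdist z (epi f)"
  proof (rule antisym)
    show "norm (z - (x, r)) \<le> infdist z (epi f)"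
    proof -
      have "epi f \<noteq> {}"
        using mem by blast
      then show ?thesis
        using dist_ge unfolding infdist_notempty[OF \<open>epi f \<noteq> {}\<close>]
        by (intro cINF_greatest) (auto simp: dist_norm)
    qed
    show "infdist z (epi f) \<le> norm (z - (x, r))"
      using infdist_le[OF mem, of z] by (simp add: dist_norm)
  qed
  moreover have "(\<zeta>, -1) = (1 / s) *\<^sub>R (z - (x, r))"
    using s_pos by (simp add: z_def)
  moreover have "1 / s > 0"
    using s_pos by simp
  ultimately have "(\<zeta>, -1) \<in> proximal_normal_cone (epi f) (x, r)"
    using mem unfolding proximal_normal_cone_def by blast
  then show ?thesis
    by (simp add: proximal_subdiff_def dom_fun_def fx)
qed

text \<open>The bound \<open>f v \<le> f y\<close> keeps \<open>v\<close> in the level set, where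
  the Lipschitz-type inclusion can be applied.\<close>

lemma ex_proximal_subdiff_near:
  fixes f :: "'a::{real_inner, complete_space} \<Rightarrow> ereal"
  assumes "lower_semicont f" and lb: "\<And>x. ereal m \<le> f x" and "f y < \<infinity>" and "e > 0"
  obtains v where "f v \<le> f y" and "norm (v - y) < e" and "proximal_subdiff f v \<noteq> {}"
proof -
  obtain v \<zeta> \<sigma> where v: "f v \<le> f y" "norm (v - y) < e" "\<sigma> > 0"
      "\<And>x. f v + ereal (\<zeta> \<bullet> (x - v) - \<sigma> * (norm (x - v))\<^sup>2) \<le> f x"
    by (rule smooth_variational_principle[OF assms]) blast
  have "f v = ereal (real_of_ereal (f v))"
    using v(1) assms(3) lb[of v] by (cases "f v") auto
  then have "\<zeta> \<in> proximal_subdiff f v"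
    using v(3,4) by (intro proximal_subdiffI) auto
  with v show thesis
    using that by blast
qed

section \<open>The ball inclusion and monotonicity of the line search\<close>

lemma set_plus_ball_elim:
  fixes a :: "'a::real_normed_vector"
  assumes "a \<in> A + (\<lambda>b. k *\<^sub>R b) ` cball 0 1" and "k \<ge> 0"
  obtains w where "w \<in> A" and "norm (a - w) \<le> k"
proof -
  obtain w b where "w \<in> A" "norm b \<le> 1" "a = w + k *\<^sub>R b"
    using assms(1) by (auto elim!: set_plus_elim)
  then show thesis
    using that[of w] assms(2) mult_left_mono[of "norm b" 1 k] by simp
qed

lemma exact_line_search_le:
  assumes "exact_line_search f a u \<epsilon>" and "0 \<le> t"
  shows "f (a + \<epsilon> *\<^sub>R u) \<le> f (a + t *\<^sub>R u)"
  using assms by (auto simp: exact_line_search_def is_arg_min_def not_less)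

text \<open>The step length 0 competes in the line search; all branches after termination leave the
  iterate unchanged.\<close>

lemma nsdm_step_le:
  assumes "nsdm_step f x v n"
  shows "f (x (Suc n)) \<le> f (x n)"
proof (cases "x (Suc n) = x n")
  case False
  then obtain u \<epsilon> where "exact_line_search f (x n) u \<epsilon>" "x (Suc n) = x n + \<epsilon> *\<^sub>R u"
    using assms unfolding nsdm_step_def Let_def by metis
  then show ?thesis
    using exact_line_search_le[of f "x n" u \<epsilon> 0] by simp
qed simp

text \<open>Only the steps before \<open>n\<close> are assumed, so that finite runs and infinite
  sequences are both covered.\<close>

lemma nsdm_step_level:
  assumes "x 0 = x0" and "\<And>k. k < n \<Longrightarrow> nsdm_step f x v k"
  shows "f (x n) \<le> f x0"
  using assms by (induction n) (auto intro: order_trans[OF nsdm_step_le])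

theorem theorem3p1:
  fixes f :: "'a::{real_inner, complete_space} \<Rightarrow> ereal"
    and x0 :: 'a
    and \<Omega> :: "'a set"
    and \<delta> L :: real
  assumes "\<forall>x. f x \<noteq> -\<infinity>"
    and "lower_semicont f"
    and "\<exists>m::real. \<forall>x. ereal m \<le> f x"
    and "x0 \<in> dom_fun f"
    and "proximal_subdiff f x0 \<noteq> {}"
    and "\<Omega> = {x. f x \<le> f x0}"
    and "\<delta> > 0"
    and "L > 0"
    and "uniformly_prox_regular_on {x. infdist x \<Omega> < \<delta>} f"
    and "\<forall>y\<in>\<Omega>. \<forall>z. norm (y - z) < \<delta> \<longrightarrow>
           proximal_subdiff f y
             \<subseteq> proximal_subdiff f z + (\<lambda>b. (L * norm (y - z)) *\<^sub>R b) ` cball 0 1"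
  shows "\<Omega> \<subseteq> {x. proximal_subdiff f x \<noteq> {}}
    \<and> (\<forall>N x v. nsdm_run f x0 N x v \<longrightarrow> (\<forall>n\<le>N. x n \<in> \<Omega> \<and> proximal_subdiff f (x n) \<noteq> {}))
    \<and> (\<forall>x xbar. nsdm_sequence f x0 x \<and> cluster_point x xbar \<longrightarrow> 0 \<in> limiting_subdiff f xbar)"
proof -
  note lsc = assms(2) and \<Omega> = assms(6) and \<delta> = assms(7) and L = assms(8)
  obtain m :: real where lb: "\<And>x. ereal m \<le> f x"
    using assms(3) by blast
  have x0: "f x0 < \<infinity>"
    using assms(4) by (simp add: dom_fun_def)
  have fin: "f z = ereal (real_of_ereal (f z))" if "f z < \<infinity>" for z
    using that assms(1)[rule_format, of z] by (cases "f z") auto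
  have fin\<Omega>: "f y < \<infinity>" if "y \<in> \<Omega>" for y
    using that x0 by (auto simp: \<Omega> intro: le_less_trans)
  have transfer: "\<exists>w'\<in>proximal_subdiff f z. norm (w - w') \<le> L * norm (y - z)"
    if "y \<in> \<Omega>" "norm (y - z) < \<delta>" "w \<in> proximal_subdiff f y" for y z w
  proof -
    have "w \<in> proximal_subdiff f z + (\<lambda>b. (L * norm (y - z)) *\<^sub>R b) ` cball 0 1"
      using assms(10) that by blast
    then show ?thesis
      by (rule set_plus_ball_elim) (use L in auto)
  qed

  \<comment> \<open>Validity of the algorithm\<close>
  have nonempty: "\<Omega> \<subseteq> {x. proximal_subdiff f x \<noteq> {}}"
  proof
    fix y assume y: "y \<in> \<Omega>"
    obtain v where v: "f v \<le> f y" "norm (v - y) < \<delta>" "proximal_subdiff f v \<noteq> {}"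
      using ex_proximal_subdiff_near[OF lsc lb fin\<Omega>[OF y] \<delta>] .
    with y have "v \<in> \<Omega>"
      by (auto simp: \<Omega>)
    \<comment> \<open>The inclusion is based at the nearby point \<open>v\<close>: a subgradient
      there forces one at \<open>y\<close>.\<close>
    with v transfer[of v y] show "y \<in> {x. proximal_subdiff f x \<noteq> {}}"
      by auto
  qed

  have run: "x n \<in> \<Omega> \<and> proximal_subdiff f (x n) \<noteq> {}" if "nsdm_run f x0 N x v" "n \<le> N" for N x v n
  proof -
    have "f (x n) \<le> f x0"
      using that by (intro nsdm_step_level[where v = v]) (auto simp: nsdm_run_def)
    then show ?thesis
      using nonempty by (auto simp: \<Omega>)
  qed

  \<comment> \<open>Uniform quadratic lower and upper bounds\<close>
  obtain \<delta>' L' where \<delta>': "\<delta>' > 0" and L': "L' > 0"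
    and upr: "\<forall>ybar\<in>{x. infdist x \<Omega> < \<delta>}. \<forall>wbar\<in>proximal_subdiff f ybar.
        \<forall>y\<in>ball ybar \<delta>'. \<forall>w\<in>proximal_subdiff f y \<inter> ball wbar \<delta>'.
          \<bar>f y - f ybar\<bar> < ereal \<delta>' \<longrightarrow>
          (\<forall>y'\<in>ball ybar \<delta>'.
             f y + ereal (w \<bullet> (y' - y)) - ereal (L' / 2 * (norm (y' - y))\<^sup>2) \<le> f y')"
    using assms(9) unfolding uniformly_prox_regular_on_def by blast
  have lower: "real_of_ereal (f z) + w \<bullet> (y - z) - L' / 2 * (norm (y - z))\<^sup>2 \<le> real_of_ereal (f y)"
    if y: "y \<in> \<Omega>" and w: "w \<in> proximal_subdiff f z" and near: "norm (y - z) < \<delta>" "norm (y - z) < \<delta>'"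
    for y z w
  proof -
    have fz: "f z < \<infinity>"
      using w by (auto simp: proximal_subdiff_def dom_fun_def)
    have "infdist z \<Omega> < \<delta>"
      using infdist_le[OF y, of z] near by (simp add: dist_norm norm_minus_commute)
    \<comment> \<open>This rests on finiteness of \<open>f z\<close>, because \<infinity> -
      \<infinity> is \<infinity> in \<open>ereal\<close>.\<close>
    moreover have "\<bar>f z - f z\<bar> < ereal \<delta>'"
      by (subst (1 2) fin[OF fz]) (use \<delta>' in simp)
    moreover have "y \<in> ball z \<delta>'"
      using near by (simp add: dist_norm norm_minus_commute)
    ultimately have "f z + ereal (w \<bullet> (y - z)) - ereal (L' / 2 * (norm (y - z))\<^sup>2) \<le> f y"
      using upr w \<delta>' by auto
    then have "ereal (real_of_ereal (f z)) + ereal (w \<bullet> (y - z)) - ereal (L' / 2 * (norm (y - z))\<^sup>2)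
        \<le> ereal (real_of_ereal (f y))"
      using fin[OF fz] fin[OF fin\<Omega>[OF y]] by simp
    then show ?thesis by simp
  qed

  \<comment> \<open>\<open>L\<close> pays for replacing a subgradient at \<open>z\<close> by one at
    \<open>y\<close>, and \<open>L' / 2\<close> is the error in \<open>lower\<close>.\<close>
  define K where "K = L + L' / 2"
  have K: "K > 0"
    using L L' by (simp add: K_def)
  have upper: "f z \<le> ereal (real_of_ereal (f y) + w \<bullet> (z - y) + K * (norm (z - y))\<^sup>2)"
    if y: "y \<in> \<Omega>" and w: "w \<in> proximal_subdiff f y" and near: "norm (y - z) < \<delta>" "norm (y - z) < \<delta>'"
    for y z w
  proof -
    obtain w' where w': "w' \<in> proximal_subdiff f z" "norm (w - w') \<le> L * norm (y - z)"
      using transfer[OF y near(1) w] by blast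
    have "(w' - w) \<bullet> (z - y) \<le> norm (w' - w) * norm (z - y)"
      by (rule norm_cauchy_schwarz)
    also have "\<dots> \<le> L * (norm (z - y))\<^sup>2"
      using w'(2) mult_right_mono[of "norm (w' - w)" "L * norm (y - z)" "norm (z - y)"]
      by (simp add: norm_minus_commute power2_eq_square mult.assoc)
    finally have "(w' - w) \<bullet> (z - y) \<le> L * (norm (z - y))\<^sup>2" .
    moreover have "w' \<bullet> (y - z) = - (w \<bullet> (z - y)) - (w' - w) \<bullet> (z - y)"
      by (simp add: algebra_simps)
    \<comment> \<open>The lower bound centred at \<open>z\<close> and tested at \<open>y\<close> is
      an upper bound for \<open>f z\<close>.\<close>
    ultimately have "real_of_ereal (f z) \<le> real_of_ereal (f y) + w \<bullet> (z - y) + K * (norm (z - y))\<^sup>2"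
      using lower[OF y w'(1) near] by (simp add: K_def norm_minus_commute algebra_simps)
    moreover have "f z < \<infinity>"
      using w'(1) by (auto simp: proximal_subdiff_def dom_fun_def)
    ultimately show ?thesis
      by (subst fin) auto
  qed

  \<comment> \<open>Stationarity of cluster points\<close>
  have stationary: "0 \<in> limiting_subdiff f xbar"
    if seq: "nsdm_sequence f x0 x" and cl: "cluster_point x xbar" for x xbar
  proof -
    obtain v where x_0: "x 0 = x0" and step: "\<And>n. nsdm_step f x v n"
      using seq by (auto simp: nsdm_sequence_def)
    obtain r where r: "strict_mono r" "(x \<circ> r) \<longlonglongrightarrow> xbar"
      using cl by (auto simp: cluster_point_def)
    have x\<Omega>: "x n \<in> \<Omega>" for n
      using nsdm_step_level[of x x0 n f v] x_0 step by (simp add: \<Omega>)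
    \<comment> \<open>With subgradients taken at \<open>xbar\<close> itself, the constant sequence
      serves in the limiting subdifferential and convergence of the values of \<open>f\<close> is
      trivial.\<close>
    have "\<exists>w. (\<forall>k. w k \<in> proximal_subdiff f xbar) \<and> w \<longlonglongrightarrow> 0"
    proof (cases "\<exists>k. v k = 0")
      case True
      \<comment> \<open>Minimality matters: \<open>nsdm_step\<close> makes \<open>v k\<close> a
        subgradient only if no earlier \<open>v i\<close> vanishes.\<close>
      define k where "k = (LEAST k. v k = 0)"
      have vk: "v k = 0"
        unfolding k_def by (rule LeastI_ex[OF True])
      have "\<not> (\<exists>i<k. v i = 0)"
        using not_less_Least k_def by blast
      then have zero: "0 \<in> proximal_subdiff f (x k)"
        using step[of k] vk by (auto simp: nsdm_step_def split: if_split_asm)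
      have const: "x n = x k" if "k \<le> n" for n
        using that
      proof (induction rule: dec_induct)
        case (step n)
        then show ?case
          using \<open>\<And>n. nsdm_step f x v n\<close>[of n] vk by (cases "n = k") (auto simp: nsdm_step_def split: if_splits)
      qed simp
      have "x k = xbar"
      proof -
        have "\<forall>\<^sub>F n in sequentially. (x \<circ> r) n = x k"
          using eventually_ge_at_top[of k]
        proof eventually_elim
          case (elim n)
          then have "k \<le> r n"
            using seq_suble[OF r(1), of n] by simp
          then show ?case
            using const[of "r n"] by simp
        qed
        then have "(x \<circ> r) \<longlonglongrightarrow> x k"
          by (rule tendsto_eventually)
        with r(2) show ?thesis
          by (rule LIMSEQ_unique[THEN sym])
      qed
      with zero show ?thesis
        by (intro exI[of _ "\<lambda>_. 0"]) simp
    next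
      case False
      then have vn: "v n \<in> proximal_subdiff f (x n)" for n
        using step[of n] by (auto simp: nsdm_step_def)
      define F where "F n = real_of_ereal (f (x n))" for n
      have fF: "f (x n) = ereal (F n)" for n
        using fin[OF fin\<Omega>[OF x\<Omega>]] by (simp add: F_def)
      have decr: "decseq F"
        using nsdm_step_le[OF step] by (intro decseq_SucI) (simp add: fF)
      have "m \<le> F n" for n
        using lb[of "x n"] by (simp add: fF)
      with decr obtain F0 where "F \<longlonglongrightarrow> F0"
        using decseq_convergent by blast
      then have Fdiff: "(\<lambda>n. F n - F (Suc n)) \<longlonglongrightarrow> 0"
        using tendsto_diff[OF _ LIMSEQ_Suc] by fastforce
      \<comment> \<open>The exact step does at least as well as the trial length \<open>t\<close>,
        where \<open>upper\<close> applies; its linear term is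
        \<open>- t * norm (v n)\<close>.\<close>
      have bound: "t * norm (v n) \<le> K * t\<^sup>2 + (F n - F (Suc n))"
        if t: "0 < t" "t < \<delta>" "t < \<delta>'" for t n
      proof -
        define u where "u = - (v n /\<^sub>R norm (v n))"
        have vn0: "norm (v n) \<noteq> 0"
          using False by auto
        have u: "norm u = 1" "v n \<bullet> u = - norm (v n)"
          using vn0 by (simp_all add: u_def dot_square_norm power2_eq_square)
        obtain \<epsilon> where "exact_line_search f (x n) u \<epsilon>" "x (Suc n) = x n + \<epsilon> *\<^sub>R u"
          using step[of n] False by (auto simp: nsdm_step_def Let_def u_def)
        then have "f (x (Suc n)) \<le> f (x n + t *\<^sub>R u)"
          using exact_line_search_le[of f "x n" u \<epsilon> t] t by simp
        also have "\<dots> \<le> ereal (F n + v n \<bullet> (t *\<^sub>R u) + K * (norm (t *\<^sub>R u))\<^sup>2)"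
          using upper[OF x\<Omega> vn, of n "x n + t *\<^sub>R u"] t u by (simp add: F_def)
        finally show ?thesis
          using u by (simp add: fF power_mult_distrib)
      qed
      have v0: "v \<longlonglongrightarrow> 0"
      proof (rule LIMSEQ_I)
        fix \<eta> :: real assume \<eta>: "\<eta> > 0"
        \<comment> \<open>Halving makes \<open>t\<close> admissible in \<open>bound\<close> and
          gives \<open>K * t \<le> \<eta> / 2\<close>; the other half of \<open>\<eta>\<close> is
          left for the decrement of \<open>F\<close> divided by \<open>t\<close>.\<close>
        define t where "t = min (min \<delta> \<delta>') (\<eta> / K) / 2"
        have t: "0 < t" "t < \<delta>" "t < \<delta>'"
          using \<eta> K \<delta> \<delta>' by (auto simp: t_def min_def)
        have "t \<le> \<eta> / K / 2"
          by (simp add: t_def)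
        then have Kt: "K * t \<le> \<eta> / 2"
          using K by (simp add: field_simps)
        have "t * (\<eta> / 2) > 0"
          using t \<eta> by simp
        from order_tendstoD(2)[OF Fdiff this]
        obtain N where N: "\<And>n. n \<ge> N \<Longrightarrow> F n - F (Suc n) < t * (\<eta> / 2)"
          unfolding eventually_sequentially by blast
        have "norm (v n - 0) < \<eta>" if "n \<ge> N" for n
        proof -
          have "t * norm (v n) < K * t\<^sup>2 + t * (\<eta> / 2)"
            using bound[OF t, of n] N[OF that] by simp
          also have "\<dots> = t * (K * t + \<eta> / 2)"
            by (simp add: algebra_simps power2_eq_square)
          finally show ?thesis
            using t Kt by simp
        qed
        then show "\<exists>N. \<forall>n\<ge>N. norm (v n - 0) < \<eta>" by blast
      qed
      have dist0: "(\<lambda>n. norm ((x \<circ> r) n - xbar)) \<longlonglongrightarrow> 0"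
        using r(2) by (intro tendsto_norm_zero LIM_zero)
      from order_tendstoD(2)[OF dist0 \<delta>]
      obtain N where N: "\<And>n. n \<ge> N \<Longrightarrow> norm (x (r n) - xbar) < \<delta>"
        by (auto simp: eventually_sequentially)
      \<comment> \<open>The shift by \<open>N\<close> brings every term within
        \<open>\<delta>\<close> of \<open>xbar\<close>, so each \<open>v (r (n + N))\<close> has a
        companion subgradient at \<open>xbar\<close>.\<close>
      have "\<exists>w'\<in>proximal_subdiff f xbar.
          norm (v (r (n + N)) - w') \<le> L * norm (x (r (n + N)) - xbar)" for n
        using transfer[OF x\<Omega> N vn] by simp
      then obtain w where w: "\<And>n. w n \<in> proximal_subdiff f xbar"
          "\<And>n. norm (v (r (n + N)) - w n) \<le> L * norm (x (r (n + N)) - xbar)"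
        by metis
      have "(\<lambda>n. L * norm (x (r (n + N)) - xbar)) \<longlonglongrightarrow> 0"
        using LIMSEQ_ignore_initial_segment[OF dist0, of N]
        by (intro tendsto_mult_right_zero) simp
      then have "(\<lambda>n. v (r (n + N)) - w n) \<longlonglongrightarrow> 0"
        by (rule Lim_null_comparison[OF always_eventually, rotated]) (use w(2) in blast)
      moreover have "(\<lambda>n. v (r (n + N))) \<longlonglongrightarrow> 0"
        using LIMSEQ_ignore_initial_segment[OF LIMSEQ_subseq_LIMSEQ[OF v0 r(1)], of N] by simp
      ultimately have "(\<lambda>n. v (r (n + N)) - (v (r (n + N)) - w n)) \<longlonglongrightarrow> 0 - 0"
        by (intro tendsto_diff)
      then have "w \<longlonglongrightarrow> 0" by simp
      with w(1) show ?thesis by blast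
    qed
    then obtain w where w: "\<And>k. w k \<in> proximal_subdiff f xbar" "w \<longlonglongrightarrow> 0"
      by blast
    have "weakly_converges w 0"
      unfolding weakly_converges_def by (intro allI tendsto_inner w(2) tendsto_const)
    moreover have "xbar \<in> dom_fun f"
      using w(1)[of 0] by (simp add: proximal_subdiff_def)
    ultimately show ?thesis
      unfolding limiting_subdiff_def using w(1)
      by (intro CollectI conjI exI[of _ "\<lambda>_. xbar"] exI[of _ w]) auto
  qed

  show ?thesis
    using nonempty run stationary by blast
qed

end
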